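(* For $m\ge1$, $n\ge0$, $k\ge0$, $$\tilde S^o[m,n,k]=\sum_{\omega\in\tilde S^o([n^m],k)}q^{\operatorname{inv}\omega},$$ where $\tilde S^o[m,n,k]=[km]!_m\,h_{n-k}([m-1],[2m-1],\dots,[(k+1)m-1])$.
   Context: $[j]=1+q+\dots+q^{j-1}$; $[km]!_m=[m][2m]\cdots[km]$ (empty product $1$ for $k=0$); $h_j$ is the complete homogeneous symmetric polynomial of degree $j$. Let $\zeta_m=e^{2\pi i/m}$, $i^c=\zeta_m^c\mathbf e_i$ for $i\in[n]$ (colors mod $m$), $[n^m]=\{0\}\cup\{i^c:i\in[n],0\le c<m\}$, $zS=\{zs:s\in S\}$. A colored set partition of type $(m,n)$ is a set partition of $[n^m]$ into blocks $S_0,\dots,S_{km}$ with (i) $0\in S_0$ and if some $i^c\in S_0$ then all $i^d\in S_0$; (ii) the nonzero blocks split into $k$ groups of $m$ distinct blocks of the form $S,\zeta_mS,\dots,\zeta_m^{m-1}S$. A super set partition additionally carries, for each base $i$ whose colors lie in $S_0$, a linear order of $\{i^0,\dots,i^{m-1}\}$ of the form $i^c,i^{c+1},\dots,i^{c+m-1}$ (exponents mod $m$) with $c\in\{1,\dots,m-1\}$. An ordered super set partition is a sequence $\omega=(S_0/S_1/\dots/S_{km})$ whose blocks (with the orders on $S_0$) form a super set partition with zero block $S_0$, and such that $S_{i+1}=\zeta_mS_i$ for every $i\in[km-1]$ not divisible by $m$; $\tilde S^o([n^m],k)$ is the set of these with $km+1$ blocks. With $\operatorname{minb}S$ the least base occurring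 in $S$ (and $0$ if $0\in S$), the inversions of $\omega$ are (1) pairs $(i^0,S_l)$ with $i^0\in S_j$, $j<l$, and $i\ge\operatorname{minb}S_l$, and (2) pairs $(i^0,i^c)$ with $i^0,i^c\in S_0$ and $i^c$ after $i^0$ in the order of base $i$; $\operatorname{inv}\omega$ is their number. *)

theory Defs
  imports Complex_Main "HOL-Library.Disjoint_Sets" "HOL-Library.Multiset"
    "HOL-Computational_Algebra.Polynomial"
begin

text \<open>The indeterminate \<open>q\<close> is \<open>monom 1 1\<close>.\<close>

definition qint :: "nat \<Rightarrow> int poly" where
  "qint j = (\<Sum>i<j. monom 1 i)"

text \<open>\<open>qfact_step k m\<close> is the product \<open>[m] [2m] \<dots> [km]\<close>.\<close>

definition qfact_step :: "nat \<Rightarrow> nat \<Rightarrow> int poly" where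
  "qfact_step k m = (\<Prod>j\<in>{1..k}. qint (j * m))"

text \<open>The complete homogeneous symmetric polynomial of degree \<open>j\<close> in the variables
  \<open>x i\<close>, \<open>i \<in> I\<close>: monomials are multisets of indices. The degree is an integer, so that
  the polynomial is 0 in negative degree.\<close>

definition complete_homogeneous :: "int \<Rightarrow> 'i set \<Rightarrow> ('i \<Rightarrow> 'a) \<Rightarrow> 'a::comm_semiring_1" where
  "complete_homogeneous j I x =
     (\<Sum>M | int (size M) = j \<and> set_mset M \<subseteq> I. \<Prod>i\<in>#M. x i)"

text \<open>For \<open>m \<ge> 1\<close> the natural number subtraction below does not truncate.\<close>

definition super_ordered_stirling :: "nat \<Rightarrow> nat \<Rightarrow> nat \<Rightarrow> int poly" where
  "super_ordered_stirling m n k =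
     qfact_step k m *
     complete_homogeneous (int n - int k) {1..k + 1} (\<lambda>i. qint (i * m - 1))"

text \<open>Vectors are functions from coordinates to complex numbers; only the coordinates
  \<open>1, \<dots>, n\<close> are used. Exponents of \<open>\<zeta>\<^sub>m\<close> need not be reduced modulo \<open>m\<close>.\<close>

type_synonym cvec = "nat \<Rightarrow> complex"

definition zeta :: "nat \<Rightarrow> complex" where
  "zeta m = exp (2 * of_real pi * \<i> / of_nat m)"

definition zero_vec :: cvec where
  "zero_vec = (\<lambda>_. 0)"

definition colored :: "nat \<Rightarrow> nat \<Rightarrow> nat \<Rightarrow> cvec" where
  "colored m i c = (\<lambda>j. if j = i then zeta m ^ c else 0)"

definition colored_set :: "nat \<Rightarrow> nat \<Rightarrow> cvec set" where
  "colored_set m n = insert zero_vec {colored m i c | i c. i \<in> {1..n} \<and> c < m}"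

definition scale_set :: "complex \<Rightarrow> cvec set \<Rightarrow> cvec set" where
  "scale_set z S = (\<lambda>s j. z * s j) ` S"

text \<open>\<open>P\<close> is the set of all blocks and \<open>Z\<close> is its zero block. The set \<open>G\<close> collects the
  \<open>k\<close> groups into which the nonzero blocks are split.\<close>

definition colored_set_partition ::
  "nat \<Rightarrow> nat \<Rightarrow> nat \<Rightarrow> cvec set set \<Rightarrow> cvec set \<Rightarrow> bool" where
  "colored_set_partition m n k P Z \<longleftrightarrow>
     partition_on (colored_set m n) P \<and>
     Z \<in> P \<and> zero_vec \<in> Z \<and>
     (\<forall>i\<in>{1..n}. (\<exists>c<m. colored m i c \<in> Z) \<longrightarrow> (\<forall>d<m. colored m i d \<in> Z)) \<and>
     (\<exists>G. partition_on (P - {Z}) G \<and> card G = k \<and>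
        (\<forall>g\<in>G. card g = m \<and> (\<exists>S. g = (\<lambda>j. scale_set (zeta m ^ j) S) ` {..<m})))"

text \<open>A linear order of a finite set is given by the list of its elements in increasing
  order; \<open>ord i\<close> is defined exactly for the bases \<open>i\<close> whose colors lie in the zero block.\<close>

definition super_set_partition ::
  "nat \<Rightarrow> nat \<Rightarrow> nat \<Rightarrow> cvec set set \<Rightarrow> cvec set \<Rightarrow> (nat \<rightharpoonup> cvec list) \<Rightarrow> bool" where
  "super_set_partition m n k P Z ord \<longleftrightarrow>
     colored_set_partition m n k P Z \<and>
     dom ord = {i \<in> {1..n}. \<forall>c<m. colored m i c \<in> Z} \<and>
     (\<forall>i\<in>dom ord. \<exists>c\<in>{1..<m}. ord i = Some (map (\<lambda>d. colored m i (c + d)) [0..<m]))"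

definition ordered_super_set_partitions ::
  "nat \<Rightarrow> nat \<Rightarrow> nat \<Rightarrow> (cvec set list \<times> (nat \<rightharpoonup> cvec list)) set" where
  "ordered_super_set_partitions m n k =
     {(Ss, ord).
        length Ss = k * m + 1 \<and> distinct Ss \<and>
        super_set_partition m n k (set Ss) (Ss ! 0) ord \<and>
        (\<forall>i\<in>{1..<k * m}. \<not> m dvd i \<longrightarrow> Ss ! (i + 1) = scale_set (zeta m) (Ss ! i))}"

definition minb :: "nat \<Rightarrow> cvec set \<Rightarrow> nat" where
  "minb m S = (if zero_vec \<in> S then 0 else (LEAST i. \<exists>c<m. colored m i c \<in> S))"

definition block_inversions :: "nat \<Rightarrow> cvec set list \<Rightarrow> (cvec \<times> cvec set) set" where
  "block_inversions m Ss =
     {(colored m i 0, Ss ! l) | i j l.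
        j < l \<and> l < length Ss \<and> colored m i 0 \<in> Ss ! j \<and> i \<ge> minb m (Ss ! l)}"

definition occurs_after :: "'a list \<Rightarrow> 'a \<Rightarrow> 'a \<Rightarrow> bool" where
  "occurs_after xs y x \<longleftrightarrow> (\<exists>a b. a < b \<and> b < length xs \<and> xs ! a = x \<and> xs ! b = y)"

definition order_inversions ::
  "nat \<Rightarrow> cvec set \<Rightarrow> (nat \<rightharpoonup> cvec list) \<Rightarrow> (cvec \<times> cvec) set" where
  "order_inversions m Z ord =
     {(colored m i 0, colored m i c) | i c L.
        c < m \<and> colored m i 0 \<in> Z \<and> colored m i c \<in> Z \<and>
        ord i = Some L \<and> occurs_after L (colored m i c) (colored m i 0)}"

definition inv_count :: "nat \<Rightarrow> cvec set list \<times> (nat \<rightharpoonup> cvec list) \<Rightarrow> nat" where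
  "inv_count m \<omega> = (case \<omega> of (Ss, ord) \<Rightarrow>
     card (block_inversions m Ss) + card (order_inversions m (Ss ! 0) ord))"

end

(* A base i is placed by a letter (g, r): either its colors lie in the zero block (g = 0), with one
   of m - 1 orders, or color 0 of i lies in one of the m blocks of the g-th group, which fixes the
   blocks of all other colors. Hence ordered super set partitions are words of length n over these
   letters that use every group. All blocks of a group have the same minb, so the inversions of i
   are r inversions inside its own group or order, plus m for each later group already used by a
   base at most i. Deleting the last letter gives the recursion
     F(n + 1, k) = [(k + 1) m - 1] F(n, k) + [k m] F(n, k - 1),
   the two terms corresponding to a last letter in an old group and in a new group. The recursion
   of the complete homogeneous polynomials in their last variable shows that the left hand side
   satisfies it as well. *)
theory Submission
  imports Defs "HOL-Analysis.Complex_Transcendental"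
begin

section \<open>The recursion of the super Stirling numbers\<close>

lemma finite_multisets_size:
  assumes "finite I"
  shows "finite {M. int (size M) = j \<and> set_mset M \<subseteq> I}"
proof (rule finite_subset)
  show "{M. int (size M) = j \<and> set_mset M \<subseteq> I} \<subseteq> mset ` {xs. set xs \<subseteq> I \<and> length xs = nat j}"
  proof
    fix M assume M: "M \<in> {M. int (size M) = j \<and> set_mset M \<subseteq> I}"
    obtain xs where "mset xs = M" using ex_mset by blast
    then show "M \<in> mset ` {xs. set xs \<subseteq> I \<and> length xs = nat j}" using M by fastforce
  qed
qed (simp add: assms finite_lists_length_eq)

text \<open>Multisets without \<open>a\<close> are those over \<open>I\<close>; the others arise,
  each once, by adding one \<open>a\<close> to a multiset of size \<open>j - 1\<close>.\<close>

lemma complete_homogeneous_insert: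
  assumes "finite I" "a \<notin> I"
  shows "complete_homogeneous j (insert a I) x =
    complete_homogeneous j I x + x a * complete_homogeneous (j - 1) (insert a I) x"
proof -
  let ?S = "\<lambda>j I. {M. int (size M) = j \<and> set_mset M \<subseteq> I}"
  have split: "?S j (insert a I) = ?S j I \<union> add_mset a ` ?S (j - 1) (insert a I)"
  proof (intro equalityI subsetI)
    fix M assume M: "M \<in> ?S j (insert a I)"
    show "M \<in> ?S j I \<union> add_mset a ` ?S (j - 1) (insert a I)"
    proof (cases "a \<in># M")
      case True
      then obtain N where "M = add_mset a N" by (metis mset_add)
      then show ?thesis using M by auto
    qed (use M in auto)
  qed auto
  have fin: "finite (?S j I)" "finite (add_mset a ` ?S (j - 1) (insert a I))"
    by (rule finite_imageI finite_multisets_size finite.insertI assms(1))+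
  have disj: "?S j I \<inter> add_mset a ` ?S (j - 1) (insert a I) = {}"
  proof (rule equals0I)
    fix M assume M: "M \<in> ?S j I \<inter> add_mset a ` ?S (j - 1) (insert a I)"
    then obtain N where "M = add_mset a N" by blast
    then have "a \<in># M" by simp
    then show False using M assms(2) by blast
  qed
  have "complete_homogeneous j (insert a I) x =
    (\<Sum>M\<in>?S j I. \<Prod>i\<in>#M. x i) +
    (\<Sum>M\<in>add_mset a ` ?S (j - 1) (insert a I). \<Prod>i\<in>#M. x i)"
    unfolding complete_homogeneous_def split by (rule sum.union_disjoint[OF fin disj])
  also have "(\<Sum>M\<in>add_mset a ` ?S (j - 1) (insert a I). \<Prod>i\<in>#M. x i) =
    x a * complete_homogeneous (j - 1) (insert a I) x"
    unfolding complete_homogeneous_def sum_distrib_left by (subst sum.reindex) (simp_all add: inj_on_def)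
  finally show ?thesis
    by (simp only: complete_homogeneous_def)
qed

lemma complete_homogeneous_neg: "j < 0 \<Longrightarrow> complete_homogeneous j I x = 0"
  by (auto simp: complete_homogeneous_def intro!: sum.neutral)

lemma complete_homogeneous_0: "complete_homogeneous 0 I x = 1"
proof -
  have "{M. int (size M) = 0 \<and> set_mset M \<subseteq> I} = {{#}}" by auto
  then show ?thesis by (simp add: complete_homogeneous_def)
qed

lemma complete_homogeneous_empty:
  assumes "j \<noteq> 0"
  shows "complete_homogeneous j ({} :: 'i set) x = 0"
proof -
  have "{M. int (size M) = j \<and> set_mset M \<subseteq> ({} :: 'i set)} = {}" using assms by auto
  then show ?thesis by (simp only: complete_homogeneous_def sum.empty)
qed

lemma super_ordered_stirling_0: "super_ordered_stirling m 0 k = (if k = 0 then 1 else 0)"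
  by (auto simp: super_ordered_stirling_def complete_homogeneous_neg complete_homogeneous_0
      qfact_step_def)

text \<open>Splitting off the last variable \<open>qint ((k + 1) * m - 1)\<close>: the terms without
  it have degree \<open>n - (k - 1)\<close> in the first \<open>k\<close> variables and belong to
  index \<open>k - 1\<close> once \<open>qint (k * m)\<close> is taken out of the product. For
  \<open>k = 0\<close> no variable is left while the degree \<open>n + 1\<close> is positive, so
  these terms vanish.\<close>

lemma super_ordered_stirling_Suc:
  "super_ordered_stirling m (Suc n) k =
    qint ((k + 1) * m - 1) * super_ordered_stirling m n k +
    (if k = 0 then 0 else qint (k * m) * super_ordered_stirling m n (k - 1))"
proof -
  have "{1..k + 1} = insert (k + 1) {1..k}" by auto
  then have *: "complete_homogeneous (int (Suc n) - int k) {1..k + 1} (\<lambda>i. qint (i * m - 1)) =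
    complete_homogeneous (int (Suc n) - int k) {1..k} (\<lambda>i. qint (i * m - 1)) +
    qint ((k + 1) * m - 1) *
      complete_homogeneous (int n - int k) {1..k + 1} (\<lambda>i. qint (i * m - 1))"
    using complete_homogeneous_insert[of "{1..k}" "k + 1" "int (Suc n) - int k"
        "\<lambda>i. qint (i * m - 1)"] by simp
  show ?thesis
  proof (cases k)
    case 0
    with * show ?thesis
      by (simp add: super_ordered_stirling_def complete_homogeneous_empty algebra_simps)
  next
    case (Suc l)
    then have fact: "qfact_step k m = qfact_step l m * qint (k * m)"
      and eqs: "{1..k} = {1..k - 1 + 1}" "int (Suc n) - int k = int n - int (k - 1)" "k - 1 = l"
      by (simp_all add: qfact_step_def)
    have "super_ordered_stirling m (Suc n) k = qfact_step k m *
      (complete_homogeneous (int n - int (k - 1)) {1..k - 1 + 1} (\<lambda>i. qint (i * m - 1)) +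
       qint ((k + 1) * m - 1) *
        complete_homogeneous (int n - int k) {1..k + 1} (\<lambda>i. qint (i * m - 1)))"
      unfolding super_ordered_stirling_def * unfolding eqs(1,2) ..
    also have "\<dots> = qint (k * m) * super_ordered_stirling m n (k - 1) +
      qint ((k + 1) * m - 1) * super_ordered_stirling m n k"
      unfolding super_ordered_stirling_def distrib_left by (simp only: fact eqs(3) mult_ac)
    finally show ?thesis
      unfolding Suc by (simp only: nat.distinct if_False add.commute)
  qed
qed

section \<open>q-integers as sums over quotients and remainders\<close>

lemma qint_add: "qint (a + b) = qint a + monom 1 a * qint b"
  by (induction b) (simp_all add: qint_def distrib_left mult_monom add.assoc)

lemma sum_monom_Times:
  "(\<Sum>x\<in>A \<times> {..<m}. monom 1 (snd x + f (fst x))) = (\<Sum>g\<in>A. monom 1 (f g)) * qint m"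
  unfolding qint_def sum_product sum.cartesian_product
  by (rule sum.cong[OF refl]) (auto simp: mult_monom add.commute)

text \<open>The exponents are the numbers below \<open>k * m\<close>, each written once with
  quotient \<open>k - g\<close> and remainder \<open>r\<close> on division by
  \<open>m\<close>.\<close>

lemma qint_mult:
  "(\<Sum>x\<in>{1..k} \<times> {..<m}. monom 1 (snd x + m * (k - fst x))) = qint (k * m)"
proof -
  have "(\<Sum>g\<in>{1..k}. monom (1::int) (m * (k - g))) = (\<Sum>g<k. monom 1 (m * g))"
    by (rule sum.reindex_bij_witness[of _ "\<lambda>g. k - g" "\<lambda>g. k - g"]) auto
  moreover have "(\<Sum>g<k. monom 1 (m * g)) * qint m = qint (k * m)"
  proof (induction k)
    case (Suc k)
    then show ?case
      using qint_add[of "k * m" m] by (simp add: algebra_simps)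
  qed (simp add: qint_def)
  ultimately show ?thesis
    unfolding sum_monom_Times[where f = "\<lambda>g. m * (k - g)"] by simp
qed

section \<open>Words and their weights\<close>

text \<open>The letter \<open>(g, r)\<close> at index \<open>i - 1\<close> of a word stands for the placement of the base \<open>i\<close>:
  for \<open>g = 0\<close> its colors lie in the zero block and their order starts with color \<open>r + 1\<close>;
  for \<open>g > 0\<close> the color 0 of \<open>i\<close> lies in the block \<open>g m - r\<close>, which belongs to the
  \<open>g\<close>-th group. Then \<open>r\<close> is the number of inversions of \<open>i\<close> inside its group or order.\<close>

definition letters :: "nat \<Rightarrow> nat \<Rightarrow> (nat \<times> nat) set" where
  "letters m k = {0} \<times> {..<m - 1} \<union> {1..k} \<times> {..<m}"

definition words :: "nat \<Rightarrow> nat \<Rightarrow> nat \<Rightarrow> (nat \<times> nat) list set" where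
  "words m n k = {xs. length xs = n \<and> set xs \<subseteq> letters m k \<and> {1..k} \<subseteq> fst ` set xs}"

text \<open>The inversion number read off from letters: each later group used by a base at most as
  large adds all of its \<open>m\<close> blocks. The prefix includes the letter itself, whose group
  the strict comparison leaves out.\<close>

definition weight :: "nat \<Rightarrow> (nat \<times> nat) list \<Rightarrow> nat" where
  "weight m xs = (\<Sum>i<length xs. snd (xs ! i) +
     m * card {g \<in> fst ` set (take (Suc i) xs). fst (xs ! i) < g})"

lemma finite_letters: "finite (letters m k)"
  by (simp add: letters_def)

lemma finite_words: "finite (words m n k)"
  by (rule finite_subset[OF _ finite_lists_length_eq[OF finite_letters, of m k n]])
    (auto simp: words_def)

lemma weight_snoc:
  "weight m (xs @ [x]) =
    weight m xs + snd x + m * card {g \<in> fst ` set (xs @ [x]). fst x < g}"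
  by (simp add: weight_def nth_append)

text \<open>Group numbers enter the weight only through comparisons, which an increasing renumbering
  preserves.\<close>

lemma weight_map:
  assumes "strict_mono s"
  shows "weight m (map (apfst s) xs) = weight m xs"
proof -
  have "{g \<in> fst ` apfst s ` A. s h < g} = s ` {g \<in> fst ` A. h < g}" for A :: "(nat \<times> nat) set" and h
    using strict_mono_less[OF assms] by (auto simp: image_iff)
  moreover have "inj_on s A" for A
    using strict_mono_imp_inj_on[OF assms] inj_on_subset by blast
  ultimately show ?thesis
    by (simp add: weight_def take_map card_image)
qed

text \<open>The increasing enumeration of the numbers other than \<open>g\<close>, which makes room
  for a new group \<open>g\<close>. For \<open>g > 0\<close> it fixes 0, so letters of the zero
  block stay there.\<close>

definition skip :: "nat \<Rightarrow> nat \<Rightarrow> nat" where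
  "skip g h = (if h < g then h else Suc h)"

definition unskip :: "nat \<Rightarrow> nat \<Rightarrow> nat" where
  "unskip g h = (if h < g then h else h - 1)"

lemma strict_mono_skip: "strict_mono (skip g)"
  by (auto simp: strict_mono_def skip_def)

lemma skip_unskip: "h \<noteq> g \<Longrightarrow> skip g (unskip g h) = h"
  by (auto simp: skip_def unskip_def)

lemma unskip_skip: "unskip g (skip g h) = h"
  by (auto simp: skip_def unskip_def)

lemma skip_neq: "skip g h \<noteq> g"
  by (auto simp: skip_def)

text \<open>\<open>k - fst x\<close> is the number of later groups when all of them are used. The
  letters of the groups give \<open>qint (k * m)\<close>, and those of the zero block continue with
  the next \<open>m - 1\<close> exponents.\<close>

lemma letters_sum:
  assumes "m \<ge> 1"
  shows "(\<Sum>x\<in>letters m k. monom 1 (snd x + m * (k - fst x))) = qint ((k + 1) * m - 1)"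
proof -
  have "(\<Sum>x\<in>letters m k. monom 1 (snd x + m * (k - fst x))) =
    (\<Sum>x\<in>{0} \<times> {..<m - 1}. monom 1 (snd x + m * (k - fst x))) +
    (\<Sum>x\<in>{1..k} \<times> {..<m}. monom (1::int) (snd x + m * (k - fst x)))"
    unfolding letters_def by (rule sum.union_disjoint) auto
  also have "\<dots> = monom 1 (k * m) * qint (m - 1) + qint (k * m)"
    unfolding qint_mult unfolding sum_monom_Times[where f = "\<lambda>g. m * (k - g)"]
    by (simp add: mult.commute)
  also have "\<dots> = qint (k * m + (m - 1))"
    unfolding qint_add by (rule add.commute)
  also have "k * m + (m - 1) = (k + 1) * m - 1"
    using assms by simp
  finally show ?thesis .
qed

text \<open>The last letter either leaves the set of used groups unchanged or is the only one in its
  group, which is then deleted by renumbering the later groups.\<close>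

lemma words_Suc:
  "words m (Suc n) k =
    (\<lambda>(xs, x). xs @ [x]) ` (words m n k \<times> letters m k) \<union>
    (\<lambda>(xs, x). map (apfst (skip (fst x))) xs @ [x]) ` (words m n (k - 1) \<times> ({1..k} \<times> {..<m}))"
  (is "_ = ?A \<union> ?B")
proof (intro equalityI subsetI)
  fix ys assume ys: "ys \<in> words m (Suc n) k"
  then obtain xs x where [simp]: "ys = xs @ [x]"
    by (cases ys rule: rev_cases) (auto simp: words_def)
  show "ys \<in> ?A \<union> ?B"
  proof (cases "{1..k} \<subseteq> fst ` set xs")
    case True
    then have "(xs, x) \<in> words m n k \<times> letters m k"
      using ys by (auto simp: words_def)
    then show ?thesis by force
  next
    case False
    then obtain g where g: "g \<in> {1..k}" "g \<notin> fst ` set xs" by blast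
    then have [simp]: "fst x = g" using ys by (auto simp: words_def)
    have sub: "{1..k} - {g} \<subseteq> fst ` set xs" using ys by (auto simp: words_def)
    \<comment> \<open>The earlier letters avoid \<open>g\<close>, so closing the gap at
      \<open>g\<close> can be undone by \<open>skip g\<close>.\<close>
    define zs where "zs = map (apfst (unskip g)) xs"
    have "(apfst (skip g) \<circ> apfst (unskip g)) z = id z" if "z \<in> set xs" for z
      using g(2) that by (cases z) (force simp: skip_unskip image_iff)
    then have "map (apfst (skip g)) zs = map id xs"
      unfolding zs_def map_map by (intro map_cong refl)
    then have ys_eq: "ys = map (apfst (skip g)) zs @ [x]" by simp
    have "set zs \<subseteq> letters m (k - 1)"
    proof
      fix z assume "z \<in> set zs"
      then obtain h r where hr: "(h, r) \<in> set xs" "z = (unskip g h, r)"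
        by (auto simp: zs_def)
      then have "h \<noteq> g" using g(2) by force
      moreover have "(h, r) \<in> letters m k" using hr ys by (auto simp: words_def)
      ultimately show "z \<in> letters m (k - 1)"
        using g(1) hr(2) by (auto simp: letters_def unskip_def)
    qed
    moreover have "{1..k - 1} \<subseteq> fst ` set zs"
    proof
      fix h assume "h \<in> {1..k - 1}"
      then have "skip g h \<in> {1..k} - {g}" by (auto simp: skip_def)
      then obtain r where "(skip g h, r) \<in> set xs" using sub by force
      then have "apfst (unskip g) (skip g h, r) \<in> set zs" by (force simp: zs_def)
      then show "h \<in> fst ` set zs" by (force simp: unskip_skip)
    qed
    ultimately have "zs \<in> words m n (k - 1)"
      using ys by (simp add: words_def zs_def)
    moreover have "x \<in> {1..k} \<times> {..<m}"
      using ys g(1) \<open>fst x = g\<close> by (cases x) (auto simp: words_def letters_def)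
    ultimately have "(zs, x) \<in> words m n (k - 1) \<times> ({1..k} \<times> {..<m})" by simp
    then have "ys \<in> ?B" unfolding ys_eq
      by (rule rev_image_eqI) simp
    then show ?thesis by simp
  qed
next
  fix ys assume "ys \<in> ?A \<union> ?B"
  then show "ys \<in> words m (Suc n) k"
  proof
    assume "ys \<in> ?A"
    then obtain xs x where *: "ys = xs @ [x]" "xs \<in> words m n k" "x \<in> letters m k" by auto
    then have "{1..k} \<subseteq> fst ` set ys" by (fastforce simp: words_def)
    then show ?thesis using * by (simp add: words_def)
  next
    assume "ys \<in> ?B"
    then obtain xs g r where *: "ys = map (apfst (skip g)) xs @ [(g, r)]"
      "xs \<in> words m n (k - 1)" "g \<in> {1..k}" "r < m" by auto
    have skip: "apfst (skip g) x \<in> letters m k" if "x \<in> set xs" for x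
    proof -
      have "x \<in> letters m (k - 1)" using that *(2) by (auto simp: words_def)
      then show ?thesis using *(3) by (cases x) (auto simp: letters_def skip_def)
    qed
    have used: "h \<in> fst ` set ys" if "h \<in> {1..k}" for h
    proof (cases "h = g")
      case False
      then have "unskip g h \<in> {1..k - 1}" using that *(3) by (auto simp: unskip_def)
      then obtain x where "x \<in> set xs" "fst x = unskip g h" using *(2) by (force simp: words_def)
      then have "h = fst (apfst (skip g) x)" "apfst (skip g) x \<in> set ys"
        using False by (simp_all add: skip_unskip *(1))
      then show ?thesis by blast
    qed (force simp: *(1))
    have "(g, r) \<in> letters m k" using *(3,4) by (simp add: letters_def)
    then have "set ys \<subseteq> letters m k" using skip by (auto simp: *(1))
    moreover have "{1..k} \<subseteq> fst ` set ys" using used by blast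
    moreover have "length ys = Suc n" using *(1,2) by (simp add: words_def)
    ultimately show ?thesis by (simp add: words_def)
  qed
qed

section \<open>The recursion for the weights of words\<close>

text \<open>In both cases of \<open>words_Suc\<close> the earlier letters use every group except
  possibly that of the last letter \<open>(g, r)\<close>. The last letter therefore adds
  \<open>r + m * (k - g)\<close> whatever the earlier word is, and both sums factor.\<close>

lemma words_sum_Suc:
  assumes "m \<ge> 1"
  shows "(\<Sum>xs\<in>words m (Suc n) k. monom (1::int) (weight m xs)) =
    qint ((k + 1) * m - 1) * (\<Sum>xs\<in>words m n k. monom 1 (weight m xs)) +
    qint (k * m) * (\<Sum>xs\<in>words m n (k - 1). monom 1 (weight m xs))"
proof -
  let ?f = "\<lambda>(xs, x). xs @ [x]"
  let ?h = "\<lambda>(xs, x). map (apfst (skip (fst x))) xs @ [x]"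
  let ?C = "words m n k \<times> letters m k"
  let ?D = "words m n (k - 1) \<times> ({1..k} \<times> {..<m})"
  let ?w = "\<lambda>xs. monom (1::int) (weight m xs)"
  have later: "{h \<in> fst ` set (xs @ [x]). fst x < h} = {fst x<..k}"
    if "set xs \<subseteq> letters m k" "{1..k} - {fst x} \<subseteq> fst ` set xs" for xs x
    using that by (fastforce simp: letters_def)
  have wf: "weight m (?f p) = weight m (fst p) + (snd (snd p) + m * (k - fst (snd p)))"
    if p: "p \<in> ?C" for p
  proof -
    obtain xs x where [simp]: "p = (xs, x)" by (cases p)
    have "{h \<in> fst ` set (xs @ [x]). fst x < h} = {fst x<..k}"
      using p by (intro later) (auto simp: words_def)
    then show ?thesis
      unfolding \<open>p = (xs, x)\<close> prod.case weight_snoc by simp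
  qed
  have wh: "weight m (?h p) = weight m (fst p) + (snd (snd p) + m * (k - fst (snd p)))"
    if p: "p \<in> ?D" for p
  proof -
    obtain xs x where [simp]: "p = (xs, x)" by (cases p)
    have "map (apfst (skip (fst x))) xs @ [x] \<in> words m (Suc n) k"
      unfolding words_Suc using p by force
    then have "{h \<in> fst ` set (map (apfst (skip (fst x))) xs @ [x]). fst x < h} = {fst x<..k}"
      by (intro later) (auto simp: words_def)
    then show ?thesis
      unfolding \<open>p = (xs, x)\<close> prod.case weight_snoc
      by (simp add: weight_map[OF strict_mono_skip])
  qed
  have inj_f: "inj_on ?f ?C" by (auto simp: inj_on_def)
  have "inj (map (apfst (skip g) :: nat \<times> nat \<Rightarrow> _))" for g
    using strict_mono_imp_inj_on[OF strict_mono_skip[of g]] by (intro list.inj_map) simp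
  then have inj_h: "inj_on ?h ?D" by (auto simp: inj_on_def)
  \<comment> \<open>The group of the last letter is used before in the first case, but never in the
    second, where \<open>skip\<close> avoids it.\<close>
  have disj: "?f ` ?C \<inter> ?h ` ?D = {}"
  proof (rule equals0I)
    fix ys assume ys: "ys \<in> ?f ` ?C \<inter> ?h ` ?D"
    then obtain xs x where x: "ys = xs @ [x]" "xs \<in> words m n k" by auto
    obtain zs z where z: "ys = map (apfst (skip (fst z))) zs @ [z]" "fst z \<in> {1..k}"
      using ys by auto
    have "fst z \<in> fst ` set xs" using x(2) z(2) by (auto simp: words_def)
    moreover have "xs = map (apfst (skip (fst z))) zs" using x(1) z(1) by (metis append1_eq_conv)
    ultimately have "fst z \<in> skip (fst z) ` fst ` set zs" by (simp add: image_image)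
    then show False using skip_neq by (metis imageE)
  qed
  have "(\<Sum>xs\<in>words m (Suc n) k. ?w xs) = (\<Sum>xs\<in>?f ` ?C. ?w xs) + (\<Sum>xs\<in>?h ` ?D. ?w xs)"
    unfolding words_Suc
    by (rule sum.union_disjoint) (use disj in \<open>simp_all add: finite_words finite_letters\<close>)
  also have "(\<Sum>xs\<in>?f ` ?C. ?w xs) = (\<Sum>p\<in>?C. ?w (?f p))"
    by (subst sum.reindex[OF inj_f]) simp
  also have "\<dots> = (\<Sum>p\<in>?C. ?w (fst p) * monom 1 (snd (snd p) + m * (k - fst (snd p))))"
    by (rule sum.cong[OF refl]) (simp only: wf mult_monom mult_1)
  also have "\<dots> = (\<Sum>xs\<in>words m n k. ?w xs) * qint ((k + 1) * m - 1)"
    unfolding letters_sum[OF assms, symmetric] sum_product sum.cartesian_product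
    by (rule sum.cong[OF refl]) auto
  also have "(\<Sum>xs\<in>?h ` ?D. ?w xs) = (\<Sum>p\<in>?D. ?w (?h p))"
    by (subst sum.reindex[OF inj_h]) simp
  also have "\<dots> = (\<Sum>p\<in>?D. ?w (fst p) * monom 1 (snd (snd p) + m * (k - fst (snd p))))"
    by (rule sum.cong[OF refl]) (simp only: wh mult_monom mult_1)
  also have "\<dots> = (\<Sum>xs\<in>words m n (k - 1). ?w xs) * qint (k * m)"
    unfolding qint_mult[symmetric] sum_product sum.cartesian_product
    by (rule sum.cong[OF refl]) auto
  finally show ?thesis by (simp only: mult.commute)
qed

lemma words_sum:
  assumes "m \<ge> 1"
  shows "(\<Sum>xs\<in>words m n k. monom 1 (weight m xs)) = super_ordered_stirling m n k"
proof (induction n arbitrary: k)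
  case 0
  have "words m 0 k = (if k = 0 then {[]} else {})" by (auto simp: words_def)
  then show ?case by (simp add: super_ordered_stirling_0 weight_def)
next
  case (Suc n)
  \<comment> \<open>For \<open>k = 0\<close> the index \<open>k - 1\<close> truncates to 0; the
    factor \<open>qint 0\<close> removes that term.\<close>
  have "qint 0 = 0" by (simp add: qint_def)
  then show ?case
    unfolding words_sum_Suc[OF assms] Suc super_ordered_stirling_Suc by (cases k) simp_all
qed

section \<open>Colored vectors and groups of blocks\<close>

lemma zeta_power_eq_iff:
  assumes "m \<ge> 1"
  shows "zeta m ^ a = zeta m ^ b \<longleftrightarrow> a mod m = b mod m"
proof -
  have "zeta m ^ j = exp (2 * of_real pi * \<i> * of_nat j / of_nat m)" for j
    unfolding zeta_def exp_of_nat_mult[symmetric] by (simp add: mult_ac)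
  then show ?thesis using complex_root_unity_eq[OF assms] by simp
qed

lemma zeta_nonzero: "zeta m \<noteq> 0"
  by (simp add: zeta_def)

lemma colored_eq_iff:
  assumes "m \<ge> 1"
  shows "colored m i c = colored m j d \<longleftrightarrow> i = j \<and> c mod m = d mod m"
proof
  assume "colored m i c = colored m j d"
  then have "colored m i c i = colored m j d i" by simp
  then show "i = j \<and> c mod m = d mod m"
    using zeta_power_eq_iff[OF assms] zeta_nonzero by (simp add: colored_def split: if_splits)
qed (use zeta_power_eq_iff[OF assms] in \<open>auto simp: colored_def fun_eq_iff\<close>)

lemma colored_mod: "m \<ge> 1 \<Longrightarrow> colored m i (c mod m) = colored m i c"
  by (simp add: colored_eq_iff)

lemma colored_nonzero: "colored m i c \<noteq> zero_vec"
proof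
  assume "colored m i c = zero_vec"
  then have "colored m i c i = zero_vec i" by simp
  then show False using zeta_nonzero by (simp add: colored_def Defs.zero_vec_def)
qed

lemma scale_colored: "(\<lambda>j. zeta m ^ a * colored m i c j) = colored m i (a + c)"
  by (auto simp: colored_def power_add)

lemma scale_set_scale_set: "scale_set z (scale_set w S) = scale_set (z * w) S"
  by (simp add: scale_set_def image_image mult.assoc)

lemma scale_set_1: "scale_set 1 S = S"
  by (simp add: scale_set_def)

text \<open>Exponents reduce modulo \<open>m\<close>, so colors may range over all natural numbers
  in what follows.\<close>

lemma colored_set_altdef:
  assumes "m \<ge> 1"
  shows "colored_set m n = insert zero_vec {colored m i c | i c. i \<in> {1..n}}"
proof -
  have "\<exists>d<m. colored m i c = colored m i d" for i c
    using assms colored_mod[OF assms] by (intro exI[of _ "c mod m"]) auto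
  then show ?thesis unfolding colored_set_def by blast
qed

text \<open>The steps inside group \<open>g + 1\<close> start at the indices
  \<open>g * m + 1\<close> to \<open>g * m + m - 1\<close>. None of these is a multiple of
  \<open>m\<close>, so the chain condition applies to each.\<close>

lemma chain_iterate:
  assumes "\<forall>i\<in>{1..<k * m}. \<not> m dvd i \<longrightarrow> Ss ! (i + 1) = scale_set (zeta m) (Ss ! i)"
    and "g < k" "j < m"
  shows "Ss ! (g * m + 1 + j) = scale_set (zeta m ^ j) (Ss ! (g * m + 1))"
  using assms(3)
proof (induction j)
  case (Suc j)
  have "g * m + Suc j < Suc g * m" using Suc.prems by simp
  also have "\<dots> \<le> k * m" using assms(2) by (intro mult_le_mono1) simp
  finally have "g * m + 1 + j \<in> {1..<k * m}" by simp
  moreover have "\<not> m dvd g * m + 1 + j"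
  proof
    assume "m dvd g * m + 1 + j"
    then have "m dvd Suc j" by (metis add.assoc dvd_add_right_iff dvd_triv_right plus_1_eq_Suc)
    then show False using Suc.prems dvd_imp_le by fastforce
  qed
  ultimately have "Ss ! (g * m + 1 + j + 1) = scale_set (zeta m) (Ss ! (g * m + 1 + j))"
    using assms(1) by blast
  then show ?case using Suc by (simp add: scale_set_scale_set)
qed (simp add: scale_set_1)

text \<open>The splitting of the nonzero blocks into groups is determined by their sequence.\<close>

lemma groups_of_chain:
  assumes "m \<ge> 1" "length Ss = k * m + 1" "distinct Ss"
    and chain: "\<forall>i\<in>{1..<k * m}. \<not> m dvd i \<longrightarrow> Ss ! (i + 1) = scale_set (zeta m) (Ss ! i)"
  shows "\<exists>G. partition_on (set Ss - {Ss ! 0}) G \<and> card G = k \<and>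
    (\<forall>g\<in>G. card g = m \<and> (\<exists>S. g = (\<lambda>j. scale_set (zeta m ^ j) S) ` {..<m}))"
proof -
  define grp where "grp g = (\<lambda>j. Ss ! (g * m + 1 + j)) ` {..<m}" for g
  have bound: "g * m + 1 + j < length Ss" if "g < k" "j < m" for g j
  proof -
    have "g * m + j < Suc g * m" using that by simp
    also have "\<dots> \<le> k * m" using that by (intro mult_le_mono1) simp
    finally show ?thesis using assms(2) by simp
  qed
  \<comment> \<open>Group and offset are the quotient and remainder of the index minus 1, and
    distinct indices carry distinct blocks.\<close>
  have index: "g = h \<and> i = j"
    if "g < k" "h < k" "i < m" "j < m" "Ss ! (g * m + 1 + i) = Ss ! (h * m + 1 + j)" for g h i j
  proof -
    have eq: "g * m + i = h * m + j"
      using that nth_eq_iff_index_eq[OF assms(3) bound bound] by auto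
    then have "(g * m + i) div m = (h * m + j) div m" by simp
    then have "g = h" using that by simp
    then show ?thesis using eq by simp
  qed
  have nonempty: "0 \<in> {..<m}" using assms(1) by simp
  have "set Ss - {Ss ! 0} = \<Union> (grp ` {..<k})"
  proof (intro equalityI subsetI)
    fix S assume S: "S \<in> set Ss - {Ss ! 0}"
    then obtain l where l: "l < length Ss" "S = Ss ! l" by (auto simp: in_set_conv_nth)
    then have "l \<noteq> 0" using S by auto
    have "(l - 1) div m < k" "(l - 1) mod m < m"
      using l \<open>l \<noteq> 0\<close> assms(1,2) by (auto simp: less_mult_imp_div_less)
    moreover have "(l - 1) div m * m + 1 + (l - 1) mod m = l" using \<open>l \<noteq> 0\<close> by simp
    ultimately show "S \<in> \<Union> (grp ` {..<k})"
      unfolding l(2) grp_def by (metis (no_types, lifting) UN_iff image_iff lessThan_iff)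
  next
    fix S assume "S \<in> \<Union> (grp ` {..<k})"
    then obtain g j where gj: "g < k" "j < m" "S = Ss ! (g * m + 1 + j)" by (auto simp: grp_def)
    then have "S \<in> set Ss" using bound by simp
    moreover have "S \<noteq> Ss ! 0"
      using gj(3) nth_eq_iff_index_eq[OF assms(3) bound[OF gj(1,2)], of 0]
      by (simp add: assms(2) flip: length_greater_0_conv)
    ultimately show "S \<in> set Ss - {Ss ! 0}" by simp
  qed
  then have union: "\<Union> (grp ` {..<k}) = set Ss - {Ss ! 0}" by (rule sym)
  have disj: "grp g \<inter> grp h = {}" if "g < k" "h < k" "g \<noteq> h" for g h
    using index that unfolding grp_def by fastforce
  have ne: "grp g \<noteq> {}" for g
    using nonempty unfolding grp_def by blast
  have "partition_on (set Ss - {Ss ! 0}) (grp ` {..<k})"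
    unfolding partition_on_def disjoint_def
  proof (intro conjI ballI impI)
    show "A \<inter> B = {}" if "A \<in> grp ` {..<k}" "B \<in> grp ` {..<k}" "A \<noteq> B" for A B
      using that disj by (metis imageE lessThan_iff)
    show "{} \<notin> grp ` {..<k}"
      using ne by (metis imageE)
  qed (rule union)
  moreover have "inj_on grp {..<k}"
    using disj ne by (metis Int_absorb inj_onI lessThan_iff)
  then have "card (grp ` {..<k}) = k" by (simp add: card_image)
  moreover have "card (grp g) = m" if "g < k" for g
  proof -
    have "inj_on (\<lambda>j. Ss ! (g * m + 1 + j)) {..<m}"
      using index[OF that that] by (intro inj_onI) simp
    then show ?thesis by (simp add: grp_def card_image)
  qed
  moreover have "grp g = (\<lambda>j. scale_set (zeta m ^ j) (Ss ! (g * m + 1))) ` {..<m}" if "g < k" for g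
    unfolding grp_def by (rule image_cong[OF refl]) (use chain_iterate[OF chain that] in simp)
  ultimately show ?thesis by blast
qed

text \<open>\<open>groups_of_chain\<close> supplies the splitting into groups, so membership becomes
  a condition on the sequence and its orders alone.\<close>

lemma ordered_super_set_partitions_iff:
  assumes "m \<ge> 1"
  shows "(Ss, ord) \<in> ordered_super_set_partitions m n k \<longleftrightarrow>
    length Ss = k * m + 1 \<and> distinct Ss \<and>
    partition_on (colored_set m n) (set Ss) \<and> zero_vec \<in> Ss ! 0 \<and>
    (\<forall>i\<in>{1..n}. (\<exists>c<m. colored m i c \<in> Ss ! 0) \<longrightarrow> (\<forall>d<m. colored m i d \<in> Ss ! 0)) \<and>
    dom ord = {i \<in> {1..n}. \<forall>c<m. colored m i c \<in> Ss ! 0} \<and>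
    (\<forall>i\<in>dom ord. \<exists>c\<in>{1..<m}. ord i = Some (map (\<lambda>d. colored m i (c + d)) [0..<m])) \<and>
    (\<forall>i\<in>{1..<k * m}. \<not> m dvd i \<longrightarrow> Ss ! (i + 1) = scale_set (zeta m) (Ss ! i))"
  (is "_ \<longleftrightarrow> ?R")
proof
  assume R: ?R
  then have "Ss ! 0 \<in> set Ss" by (intro nth_mem) simp
  moreover have "\<exists>G. partition_on (set Ss - {Ss ! 0}) G \<and> card G = k \<and>
    (\<forall>g\<in>G. card g = m \<and> (\<exists>S. g = (\<lambda>j. scale_set (zeta m ^ j) S) ` {..<m}))"
    using R by (intro groups_of_chain[OF assms]) blast+
  ultimately show "(Ss, ord) \<in> ordered_super_set_partitions m n k"
    using R
    unfolding ordered_super_set_partitions_def super_set_partition_def colored_set_partition_def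
      mem_Collect_eq prod.case
    by (intro conjI) blast+
next
  assume "(Ss, ord) \<in> ordered_super_set_partitions m n k"
  then show ?R
    unfolding ordered_super_set_partitions_def super_set_partition_def colored_set_partition_def
      mem_Collect_eq prod.case
    by (intro conjI) blast+
qed

section \<open>Words and ordered super set partitions\<close>

text \<open>The index of the block that receives color \<open>c\<close> of a base with letter
  \<open>x\<close>. Group \<open>g\<close> occupies the indices \<open>(g - 1) * m + 1\<close> to
  \<open>g * m\<close>. Color 0 has offset \<open>m - 1 - r\<close> there, and raising the color by
  one moves to the next block cyclically.\<close>

definition place :: "nat \<Rightarrow> nat \<times> nat \<Rightarrow> nat \<Rightarrow> nat" where
  "place m x c = (if fst x = 0 then 0 else (fst x - 1) * m + 1 + (m - 1 - snd x + c) mod m)"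

definition letter_order :: "nat \<Rightarrow> nat \<Rightarrow> nat \<times> nat \<Rightarrow> cvec list option" where
  "letter_order m i x =
    (if fst x = 0 then Some (map (\<lambda>d. colored m i (snd x + 1 + d)) [0..<m]) else None)"

lemma place_mod: "place m x (c mod m) = place m x c"
  by (simp add: place_def mod_add_right_eq)

lemma place_eq_0_iff: "place m x c = 0 \<longleftrightarrow> fst x = 0"
  by (simp add: place_def)

lemma place_0:
  assumes "x \<in> letters m k"
  shows "place m x 0 = fst x * m - (if fst x = 0 then 0 else snd x)"
proof (cases "fst x = 0")
  case False
  then obtain g where g: "fst x = Suc g" by (cases "fst x") auto
  have "snd x < m" using assms False by (auto simp: letters_def)
  then show ?thesis by (simp add: place_def g)
qed (simp add: place_def)

lemma place_group:
  assumes "m \<ge> 1" "fst x \<noteq> 0"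
  shows "(place m x c - 1) div m + 1 = fst x"
  using assms by (simp add: place_def)

lemma place_le:
  assumes "m \<ge> 1" "x \<in> letters m k"
  shows "place m x c \<le> k * m"
proof (cases "fst x = 0")
  case False
  have "(m - 1 - snd x + c) mod m < m" using assms(1) by simp
  then have "(fst x - 1) * m + 1 + (m - 1 - snd x + c) mod m \<le> (fst x - 1) * m + m" by linarith
  also have "\<dots> = fst x * m" using False by (cases "fst x") auto
  also have "\<dots> \<le> k * m" using assms(2) by (intro mult_le_mono1) (auto simp: letters_def)
  finally show ?thesis using False by (simp add: place_def)
qed (simp add: place_def)

text \<open>A wraparound leads from the last block of a group, whose index is a multiple of
  \<open>m\<close>, to the first. Away from multiples of \<open>m\<close> the next color lies in the
  next block.\<close>

lemma place_Suc_iff: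
  assumes "m \<ge> 1" "l \<ge> 1" "\<not> m dvd l"
  shows "place m x (Suc c) = Suc l \<longleftrightarrow> place m x c = l"
proof (cases "fst x")
  case (Suc g)
  define s where "s = (m - 1 - snd x + c) mod m"
  have "s < m" using assms(1) by (simp add: s_def)
  have "(m - 1 - snd x + Suc c) mod m = Suc s mod m" by (simp add: s_def mod_Suc_eq)
  then have p: "place m x (Suc c) = g * m + 1 + Suc s mod m" "place m x c = g * m + 1 + s"
    by (simp_all add: place_def Suc s_def)
  show ?thesis
  proof (cases "Suc s = m")
    case True
    then have "place m x c = Suc g * m" "place m x (Suc c) = Suc (g * m)"
      using p by simp_all
    then show ?thesis using assms(3) by (metis dvd_triv_right nat.inject)
  next
    case False
    then show ?thesis using \<open>s < m\<close> p by simp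
  qed
qed (use assms in \<open>simp add: place_def\<close>)

lemma ex_place:
  assumes "x \<in> letters m k" "fst x \<noteq> 0" "l \<ge> 1" "(l - 1) div m + 1 = fst x"
  shows "\<exists>c<m. place m x c = l"
proof -
  have r: "snd x < m" using assms(1,2) by (auto simp: letters_def)
  \<comment> \<open>From the offset \<open>m - 1 - r\<close> of color 0, \<open>r + 1\<close> steps
    wrap around to offset 0; the remaining \<open>(l - 1) mod m\<close> steps lead to
    \<open>l\<close>.\<close>
  define c where "c = (snd x + 1 + (l - 1) mod m) mod m"
  have "(m - 1 - snd x + c) mod m = (m - 1 - snd x + (snd x + 1 + (l - 1) mod m)) mod m"
    by (simp add: c_def mod_add_right_eq)
  also have "m - 1 - snd x + (snd x + 1 + (l - 1) mod m) = m + (l - 1) mod m"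
    using r by simp
  finally have "place m x c = (l - 1) div m * m + 1 + (l - 1) mod m"
    using assms(2,4) by (simp add: place_def flip: assms(4))
  then have "place m x c = l" using assms(3) by simp
  moreover have "c < m" using r by (simp add: c_def)
  ultimately show ?thesis by blast
qed

definition block :: "nat \<Rightarrow> (nat \<times> nat) list \<Rightarrow> nat \<Rightarrow> cvec set" where
  "block m xs l = {v. v = zero_vec \<and> l = 0} \<union>
    {colored m i c | i c. i \<in> {1..length xs} \<and> place m (xs ! (i - 1)) c = l}"

definition orders :: "nat \<Rightarrow> (nat \<times> nat) list \<Rightarrow> nat \<rightharpoonup> cvec list" where
  "orders m xs i = (if i \<in> {1..length xs} then letter_order m i (xs ! (i - 1)) else None)"

definition decode :: "nat \<Rightarrow> nat \<Rightarrow> (nat \<times> nat) list \<Rightarrow> cvec set list \<times> (nat \<rightharpoonup> cvec list)" where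
  "decode m k xs = (map (block m xs) [0..<k * m + 1], orders m xs)"

lemma zero_vec_in_block: "zero_vec \<in> block m xs l \<longleftrightarrow> l = 0"
  by (auto simp: block_def colored_nonzero[symmetric])

text \<open>A vector determines its base and its color modulo \<open>m\<close>, and
  \<open>place\<close> depends on the color only modulo \<open>m\<close>.\<close>

lemma colored_in_block:
  assumes "m \<ge> 1"
  shows "colored m i c \<in> block m xs l \<longleftrightarrow>
    i \<in> {1..length xs} \<and> place m (xs ! (i - 1)) c = l"
proof
  assume "colored m i c \<in> block m xs l"
  then obtain d where "c mod m = d mod m" "i \<in> {1..length xs}" "place m (xs ! (i - 1)) d = l"
    using colored_nonzero by (auto simp: block_def colored_eq_iff[OF assms])
  then show "i \<in> {1..length xs} \<and> place m (xs ! (i - 1)) c = l"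
    by (metis place_mod)
qed (auto simp: block_def)

lemma block_disjoint:
  assumes "m \<ge> 1" "v \<in> block m xs l" "v \<in> block m xs l'"
  shows "l = l'"
proof (cases "v = zero_vec")
  case True
  then show ?thesis using assms zero_vec_in_block by simp
next
  case False
  then obtain i c where "v = colored m i c" using assms(2) by (auto simp: block_def)
  then show ?thesis using assms colored_in_block by auto
qed

lemma scale_block:
  assumes "m \<ge> 1" "l \<ge> 1" "\<not> m dvd l"
  shows "scale_set (zeta m) (block m xs l) = block m xs (l + 1)"
proof (intro equalityI subsetI)
  fix v assume "v \<in> scale_set (zeta m) (block m xs l)"
  then obtain i c where "v = (\<lambda>j. zeta m * colored m i c j)"
    and ic: "i \<in> {1..length xs}" "place m (xs ! (i - 1)) c = l"
    using assms(2) by (auto simp: scale_set_def block_def)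
  then have "v = colored m i (Suc c)" using scale_colored[of m 1 i c] by simp
  then show "v \<in> block m xs (l + 1)"
    using ic by (simp add: colored_in_block[OF assms(1)] place_Suc_iff[OF assms])
next
  fix v assume "v \<in> block m xs (l + 1)"
  then obtain i c where v: "v = colored m i c"
    and ic: "i \<in> {1..length xs}" "place m (xs ! (i - 1)) c = l + 1"
    by (auto simp: block_def)
  \<comment> \<open>The color before \<open>c\<close> modulo \<open>m\<close>, written without
    subtracting from \<open>c\<close>.\<close>
  define d where "d = c + (m - 1)"
  have d: "Suc d mod m = c mod m" using assms(1) by (simp add: d_def)
  then have "place m (xs ! (i - 1)) (Suc d) = Suc l" using ic(2) by (metis Suc_eq_plus1 place_mod)
  then have "colored m i d \<in> block m xs l"
    using ic(1) by (simp add: colored_in_block[OF assms(1)] place_Suc_iff[OF assms])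
  moreover have "v = (\<lambda>j. zeta m * colored m i d j)"
    using scale_colored[of m 1 i d] v d by (simp add: colored_eq_iff[OF assms(1)])
  ultimately show "v \<in> scale_set (zeta m) (block m xs l)"
    unfolding scale_set_def by blast
qed

section \<open>Words yield ordered super set partitions\<close>

lemma words_nth:
  assumes "xs \<in> words m n k" "i \<in> {1..n}"
  shows "xs ! (i - 1) \<in> letters m k"
  using assms nth_mem[of "i - 1" xs] by (auto simp: words_def)

lemma words_used:
  assumes "xs \<in> words m n k" "g \<in> {1..k}"
  shows "\<exists>i\<in>{1..n}. fst (xs ! (i - 1)) = g"
proof -
  obtain j where "j < n" "fst (xs ! j) = g"
    using assms by (force simp: words_def in_set_conv_nth)
  then show ?thesis by (intro bexI[of _ "Suc j"]) auto
qed

lemma block_nonempty: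
  assumes "m \<ge> 1" "xs \<in> words m n k" "l \<le> k * m"
  shows "block m xs l \<noteq> {}"
proof (cases "l = 0")
  case True
  then show ?thesis using zero_vec_in_block by blast
next
  case False
  then have "l - 1 < k * m" using assms(3) by simp
  then have "(l - 1) div m + 1 \<in> {1..k}" by (simp add: less_mult_imp_div_less Suc_le_eq)
  then obtain i where i: "i \<in> {1..n}" "fst (xs ! (i - 1)) = (l - 1) div m + 1"
    using words_used[OF assms(2)] by blast
  then obtain c where "place m (xs ! (i - 1)) c = l"
    using ex_place[OF words_nth[OF assms(2) i(1)], of l] False by auto
  then have "colored m i c \<in> block m xs l"
    using i(1) assms(2) by (simp add: colored_in_block[OF assms(1)] words_def)
  then show ?thesis by blast
qed

text \<open>The blocks cover everything since every place is at most \<open>k * m\<close>, are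
  disjoint since a vector determines its place, and are nonempty since every group is used. The last
  two facts make them distinct, and \<open>scale_block\<close> gives the chain condition.\<close>

lemma decode_in:
  assumes "m \<ge> 1" "xs \<in> words m n k"
  shows "decode m k xs \<in> ordered_super_set_partitions m n k"
proof -
  let ?Ss = "map (block m xs) [0..<k * m + 1]"
  have [simp]: "length xs = n" using assms(2) by (simp add: words_def)
  have nth: "?Ss ! l = block m xs l" if "l \<le> k * m" for l
    using that nth_map_upt[of l "k * m + 1" 0] by simp
  have upt: "set [0..<k * m + 1] = {..k * m}" by auto
  then have set: "set ?Ss = block m xs ` {..k * m}" by (simp only: set_map)
  have inj: "inj_on (block m xs) {..k * m}"
  proof (rule inj_onI)
    fix l l' assume "l \<in> {..k * m}" "block m xs l = block m xs l'"
    then show "l = l'" using block_nonempty[OF assms] block_disjoint[OF assms(1)] by blast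
  qed
  then have "distinct ?Ss"
    by (simp only: distinct_map distinct_upt upt simp_thms)
  moreover have "partition_on (colored_set m n) (set ?Ss)"
    unfolding partition_on_def
  proof (intro conjI)
    show "\<Union> (set ?Ss) = colored_set m n"
      unfolding set colored_set_altdef[OF assms(1)]
    proof (intro equalityI subsetI)
      fix v assume "v \<in> insert zero_vec {colored m i c | i c. i \<in> {1..n}}"
      then consider "v = zero_vec" | i c where "v = colored m i c" "i \<in> {1..n}" by blast
      then show "v \<in> \<Union> (block m xs ` {..k * m})"
      proof cases
        case 1
        then show ?thesis using zero_vec_in_block by auto
      next
        case 2
        then have "v \<in> block m xs (place m (xs ! (i - 1)) c)"
          by (simp add: colored_in_block[OF assms(1)])
        then show ?thesis using place_le[OF assms(1) words_nth[OF assms(2) 2(2)]] by blast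
      qed
    qed (auto simp: block_def)
    show "disjoint (set ?Ss)"
      unfolding set disjoint_def using block_disjoint[OF assms(1)] by blast
    show "{} \<notin> set ?Ss"
      unfolding set using block_nonempty[OF assms] by auto
  qed
  moreover have zero: "colored m i c \<in> ?Ss ! 0 \<longleftrightarrow> i \<in> {1..n} \<and> fst (xs ! (i - 1)) = 0" for i c
    using nth[of 0] by (simp add: colored_in_block[OF assms(1)] place_eq_0_iff)
  moreover have "zero_vec \<in> ?Ss ! 0" using nth[of 0] by (simp add: zero_vec_in_block)
  moreover have dom: "i \<in> dom (orders m xs) \<longleftrightarrow> i \<in> {1..n} \<and> fst (xs ! (i - 1)) = 0" for i
    by (auto simp: domIff orders_def letter_order_def)
  moreover have "dom (orders m xs) = {i \<in> {1..n}. \<forall>c<m. colored m i c \<in> ?Ss ! 0}"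
  proof -
    have "(\<forall>c<m. P) \<longleftrightarrow> P" for P
      using assms(1) by (metis less_eq_Suc_le One_nat_def)
    then show ?thesis
      unfolding zero set_eq_iff mem_Collect_eq dom by blast
  qed
  moreover have "\<exists>c\<in>{1..<m}. orders m xs i = Some (map (\<lambda>d. colored m i (c + d)) [0..<m])"
    if "i \<in> dom (orders m xs)" for i
  proof -
    have i: "i \<in> {1..n}" "fst (xs ! (i - 1)) = 0"
      using that dom by simp_all
    \<comment> \<open>Letters of the zero block have \<open>r < m - 1\<close>, which keeps the
      starting color \<open>r + 1\<close> below \<open>m\<close>.\<close>
    then have "snd (xs ! (i - 1)) + 1 \<in> {1..<m}"
      using words_nth[OF assms(2) i(1)] by (auto simp: letters_def)
    moreover have "orders m xs i =
        Some (map (\<lambda>d. colored m i (snd (xs ! (i - 1)) + 1 + d)) [0..<m])"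
      using i by (simp add: orders_def letter_order_def)
    ultimately show ?thesis by blast
  qed
  moreover have "?Ss ! (i + 1) = scale_set (zeta m) (?Ss ! i)"
    if "i \<in> {1..<k * m}" "\<not> m dvd i" for i
    using that scale_block[OF assms(1), of i xs] nth[of i] nth[of "i + 1"] by simp
  ultimately show ?thesis
    unfolding decode_def ordered_super_set_partitions_iff[OF assms(1)] by simp
qed

section \<open>Recovering the word from its partition\<close>

text \<open>In the zero block, the first color \<open>r + 1 < m\<close> of the order determines
  \<open>r\<close>. Otherwise the index \<open>g * m - r\<close> of the block of color 0 determines
  \<open>g\<close> by division, and then \<open>r\<close>.\<close>

lemma letter_eqI:
  assumes "m \<ge> 1" "x \<in> letters m k" "y \<in> letters m k"
    and "place m x 0 = place m y 0" "letter_order m i x = letter_order m i y"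
  shows "x = y"
proof (cases "fst x = 0")
  case True
  then have y: "fst y = 0" using assms(4) place_eq_0_iff by metis
  have r: "snd x < m - 1" "snd y < m - 1" using assms(2,3) True y by (auto simp: letters_def)
  have "colored m i (snd x + 1 + 0) = colored m i (snd y + 1 + 0)"
    using assms(1) arg_cong[OF assms(5), of "\<lambda>L. the L ! 0"] True y
    by (simp add: letter_order_def)
  then have "(snd x + 1) mod m = (snd y + 1) mod m" using colored_eq_iff[OF assms(1)] by simp
  then show ?thesis using r True y by (simp add: prod_eq_iff)
next
  case False
  then have y: "fst y \<noteq> 0" using assms(4) place_eq_0_iff by metis
  have g: "fst x = fst y" using place_group[OF assms(1)] False y assms(4) by metis
  have "snd x < m" "snd y < m" using assms(2,3) False y by (auto simp: letters_def)
  moreover have "m \<le> fst y * m" using y by simp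
  moreover have "fst y * m - snd x = fst y * m - snd y"
    using assms(4) unfolding place_0[OF assms(2)] place_0[OF assms(3)] using y g by simp
  ultimately have "snd x = snd y" by linarith
  then show ?thesis using g by (simp add: prod_eq_iff)
qed

lemma inj_on_decode:
  assumes "m \<ge> 1"
  shows "inj_on (decode m k) (words m n k)"
proof (rule inj_onI)
  fix xs ys assume xs: "xs \<in> words m n k" and ys: "ys \<in> words m n k"
    and eq: "decode m k xs = decode m k ys"
  have len: "length xs = n" "length ys = n" using xs ys by (simp_all add: words_def)
  have block: "block m xs l = block m ys l" if "l \<le> k * m" for l
    using eq that by (auto simp: decode_def)
  have "xs ! (i - 1) = ys ! (i - 1)" if i: "i \<in> {1..n}" for i
  proof (rule letter_eqI[OF assms words_nth[OF xs i] words_nth[OF ys i]])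
    let ?l = "place m (xs ! (i - 1)) 0"
    have "colored m i 0 \<in> block m xs ?l"
      using i len by (simp add: colored_in_block[OF assms])
    then have "colored m i 0 \<in> block m ys ?l"
      using block[OF place_le[OF assms words_nth[OF xs i]]] by simp
    then show "?l = place m (ys ! (i - 1)) 0"
      by (simp add: colored_in_block[OF assms])
    have "orders m xs i = orders m ys i" using eq by (simp add: decode_def)
    then show "letter_order m i (xs ! (i - 1)) = letter_order m i (ys ! (i - 1))"
      using i len by (simp add: orders_def)
  qed
  from this[of "Suc j" for j] show "xs = ys"
    using len by (intro nth_equalityI) auto
qed

section \<open>Every ordered super set partition comes from a word\<close>

text \<open>Dividing by \<open>zeta m ^ s\<close> moves color 0 back to color \<open>m - s\<close>
  in the first block of the group; multiplying by \<open>zeta m ^ t\<close> with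
  \<open>t = (s + c) mod m\<close> then yields color \<open>c\<close>.\<close>

lemma colored_in_iterate:
  assumes "m \<ge> 1" "g < k" "s < m" "length Ss = k * m + 1"
    and chain: "\<forall>i\<in>{1..<k * m}. \<not> m dvd i \<longrightarrow> Ss ! (i + 1) = scale_set (zeta m) (Ss ! i)"
    and "colored m i 0 \<in> Ss ! (g * m + 1 + s)"
  shows "colored m i c \<in> Ss ! (g * m + 1 + (s + c) mod m)"
proof -
  obtain v where v: "v \<in> Ss ! (g * m + 1)" "colored m i 0 = (\<lambda>j. zeta m ^ s * v j)"
    using assms(6) unfolding chain_iterate[OF chain assms(2,3)] scale_set_def by blast
  have "zeta m ^ (m - s) * zeta m ^ s = 1"
    using zeta_power_eq_iff[OF assms(1), of m 0] assms(3) by (simp flip: power_add)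
  then have "v = (\<lambda>j. zeta m ^ (m - s) * colored m i 0 j)"
    by (simp add: v(2) flip: mult.assoc)
  then have "v = colored m i (m - s)" using scale_colored[of m "m - s" i 0] by simp
  define t where "t = (s + c) mod m"
  have "t < m" using assms(1) by (simp add: t_def)
  have "colored m i (t + (m - s)) \<in> scale_set (zeta m ^ t) (Ss ! (g * m + 1))"
    using v(1) \<open>v = colored m i (m - s)\<close> unfolding scale_set_def
    by (auto simp flip: scale_colored)
  then have "colored m i (t + (m - s)) \<in> Ss ! (g * m + 1 + t)"
    unfolding chain_iterate[OF chain assms(2) \<open>t < m\<close>] .
  moreover have "(t + (m - s)) mod m = c mod m"
  proof -
    have "(t + (m - s)) mod m = (s + c + (m - s)) mod m" by (simp add: t_def mod_add_left_eq)
    also have "s + c + (m - s) = c + m" using assms(3) by simp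
    finally show ?thesis by simp
  qed
  then have "colored m i (t + (m - s)) = colored m i c" by (simp add: colored_eq_iff[OF assms(1)])
  ultimately show ?thesis by (simp add: t_def)
qed

text \<open>The position of color 0 decides. If it lies in the zero block, so do all colors of
  \<open>i\<close>, and the order of \<open>i\<close> gives the letter; otherwise the block of color
  0 fixes the blocks of all other colors.\<close>

lemma ex_letter:
  assumes m: "m \<ge> 1" and "(Ss, ord) \<in> ordered_super_set_partitions m n k" and i: "i \<in> {1..n}"
  shows "\<exists>x\<in>letters m k. ord i = letter_order m i x \<and> (\<forall>c. colored m i c \<in> Ss ! place m x c)"
proof -
  note P = assms(2)[unfolded ordered_super_set_partitions_iff[OF m]]
  have len: "length Ss = k * m + 1" and part: "partition_on (colored_set m n) (set Ss)"
    and closed: "\<And>c d. c < m \<Longrightarrow> colored m i c \<in> Ss ! 0 \<Longrightarrow> d < m \<Longrightarrow> colored m i d \<in> Ss ! 0"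
    and dom: "dom ord = {i \<in> {1..n}. \<forall>c<m. colored m i c \<in> Ss ! 0}"
    and ord: "\<forall>i\<in>dom ord. \<exists>c\<in>{1..<m}. ord i = Some (map (\<lambda>d. colored m i (c + d)) [0..<m])"
    and chain: "\<forall>i\<in>{1..<k * m}. \<not> m dvd i \<longrightarrow> Ss ! (i + 1) = scale_set (zeta m) (Ss ! i)"
    using P i by blast+
  have "colored m i 0 \<in> \<Union> (set Ss)"
    using part i unfolding partition_on_def colored_set_altdef[OF m] by blast
  then obtain l where l: "l < length Ss" "colored m i 0 \<in> Ss ! l"
    by (metis UnionE in_set_conv_nth)
  show ?thesis
  proof (cases "l = 0")
    case True
    have all: "colored m i c \<in> Ss ! 0" for c
      using closed[of 0 "c mod m"] l True m colored_mod[OF m, of i c] by simp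
    then have "i \<in> dom ord" using dom i by blast
    then obtain c where c: "c \<in> {1..<m}" "ord i = Some (map (\<lambda>d. colored m i (c + d)) [0..<m])"
      using ord by blast
    have "(0, c - 1) \<in> letters m k" using c(1) by (auto simp: letters_def)
    moreover have "ord i = letter_order m i (0, c - 1)" using c by (simp add: letter_order_def)
    moreover have "place m (0, c - 1) d = 0" for d by (simp add: place_def)
    ultimately show ?thesis using all by metis
  next
    case False
    define g where "g = (l - 1) div m"
    define s where "s = (l - 1) mod m"
    have "l - 1 < k * m" using l(1) len False by simp
    then have g: "g < k" by (simp add: g_def less_mult_imp_div_less)
    have s: "s < m" using m by (simp add: s_def)
    have l_eq: "l = g * m + 1 + s" using False by (simp add: g_def s_def)
    have "colored m i 0 \<notin> Ss ! 0"
    proof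
      assume "colored m i 0 \<in> Ss ! 0"
      moreover have "Ss ! 0 \<in> set Ss" "Ss ! l \<in> set Ss" using l(1) len by simp_all
      moreover have "disjoint (set Ss)" using part by (simp add: partition_on_def)
      ultimately have "Ss ! 0 = Ss ! l" using l(2) unfolding disjoint_def by blast
      then show False
        using P l(1) False nth_eq_iff_index_eq[of Ss 0 l] by force
    qed
    then have "\<not> (\<forall>c<m. colored m i c \<in> Ss ! 0)" using m by (intro notI) simp
    then have "i \<notin> dom ord" using dom by blast
    \<comment> \<open>The index \<open>l = g * m + 1 + s\<close> equals
      \<open>(g + 1) * m - r\<close> exactly for \<open>r = m - 1 - s\<close>.\<close>
    then have "ord i = letter_order m i (Suc g, m - 1 - s)"
      by (simp add: letter_order_def domIff)
    moreover have "(Suc g, m - 1 - s) \<in> letters m k" using g s by (simp add: letters_def)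
    moreover have "place m (Suc g, m - 1 - s) c = g * m + 1 + (s + c) mod m" for c
      using s by (simp add: place_def)
    then have "\<forall>c. colored m i c \<in> Ss ! place m (Suc g, m - 1 - s) c"
      using colored_in_iterate[OF m g s len chain l(2)[unfolded l_eq]] by simp
    ultimately show ?thesis by blast
  qed
qed

lemma decode_surj:
  assumes m: "m \<ge> 1" and om: "(Ss, ord) \<in> ordered_super_set_partitions m n k"
  shows "(Ss, ord) \<in> decode m k ` words m n k"
proof -
  note P = om[unfolded ordered_super_set_partitions_iff[OF m]]
  have len: "length Ss = k * m + 1" and dist: "distinct Ss"
    and part: "partition_on (colored_set m n) (set Ss)"
    and zero: "zero_vec \<in> Ss ! 0" and dom: "dom ord \<subseteq> {1..n}"
    using P by blast+
  have "\<forall>i\<in>{1..n}. \<exists>x. x \<in> letters m k \<and> ord i = letter_order m i x \<and>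
    (\<forall>c. colored m i c \<in> Ss ! place m x c)"
    using ex_letter[OF m om] by blast
  from bchoice[OF this] obtain f where
    f: "\<And>i. i \<in> {1..n} \<Longrightarrow> f i \<in> letters m k" "\<And>i. i \<in> {1..n} \<Longrightarrow> ord i = letter_order m i (f i)"
      "\<And>i c. i \<in> {1..n} \<Longrightarrow> colored m i c \<in> Ss ! place m (f i) c"
    by blast
  define xs where "xs = map f [1..<Suc n]"
  have [simp]: "length xs = n" by (simp add: xs_def)
  have nth: "xs ! (i - 1) = f i" if "i \<in> {1..n}" for i
  proof -
    have "i - 1 < Suc n - 1" using that by auto
    then show ?thesis
      using nth_map_upt[of "i - 1" "Suc n" 1 f] that by (simp add: xs_def del: upt_Suc)
  qed
  have index: "a = b" if "a \<le> k * m" "b \<le> k * m" "v \<in> Ss ! a" "v \<in> Ss ! b" for a b v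
  proof -
    have "Ss ! a \<in> set Ss" "Ss ! b \<in> set Ss" using that len by simp_all
    moreover have "disjoint (set Ss)" using part by (simp add: partition_on_def)
    ultimately have "Ss ! a = Ss ! b" using that(3,4) unfolding disjoint_def by blast
    then show ?thesis using nth_eq_iff_index_eq[OF dist, of a b] that len by simp
  qed
  \<comment> \<open>One inclusion is the choice of the letters. For the other, a vector of
    \<open>Ss ! l\<close> also lies in the block at its own place, and disjointness makes the two
    indices equal.\<close>
  have block: "block m xs l = Ss ! l" if l: "l \<le> k * m" for l
  proof (intro equalityI subsetI)
    fix v assume "v \<in> block m xs l"
    then consider "v = zero_vec" "l = 0"
      | i c where "v = colored m i c" "i \<in> {1..n}" "place m (xs ! (i - 1)) c = l"
      unfolding block_def \<open>length xs = n\<close> by blast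
    then show "v \<in> Ss ! l"
      using zero f(3) nth by cases auto
  next
    fix v assume v: "v \<in> Ss ! l"
    have "Ss ! l \<in> set Ss" using l len by simp
    then have "v \<in> colored_set m n" using v part unfolding partition_on_def by blast
    then consider "v = zero_vec" | i c where "v = colored m i c" "i \<in> {1..n}"
      unfolding colored_set_altdef[OF m] by blast
    then show "v \<in> block m xs l"
    proof cases
      case 1
      then have "l = 0" using index[OF l _ v, of 0] zero by simp
      then show ?thesis using 1 zero_vec_in_block by simp
    next
      case 2
      then have "l = place m (f i) c"
        using index[OF l place_le[OF m f(1)[OF 2(2)]] v, of c] f(3)[OF 2(2)] by simp
      then show ?thesis using 2 nth by (simp add: colored_in_block[OF m])
    qed
  qed
  have "xs \<in> words m n k"
    unfolding words_def mem_Collect_eq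
  proof (intro conjI subsetI)
    show "x \<in> letters m k" if "x \<in> set xs" for x
      using that f(1) by (auto simp: xs_def)
    fix g assume g: "g \<in> {1..k}"
    \<comment> \<open>The last block of group \<open>g\<close> is nonempty, and any base with a
      color in it has a letter in group \<open>g\<close>.\<close>
    then have gm: "g * m \<le> k * m" "g * m \<noteq> 0" using m by simp_all
    then have "Ss ! (g * m) \<in> set Ss" using len by (intro nth_mem) linarith
    then have "Ss ! (g * m) \<noteq> {}" using part unfolding partition_on_def by metis
    then obtain v where "v \<in> block m xs (g * m)" using block[OF gm(1)] by blast
    then obtain i c where ic: "i \<in> {1..n}" "place m (xs ! (i - 1)) c = g * m"
      using gm(2) unfolding block_def by auto
    then have nz: "fst (xs ! (i - 1)) \<noteq> 0" using gm(2) place_eq_0_iff[of m _ c] by metis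
    have eq: "g * m - 1 = m - 1 + (g - 1) * m" using g m by (cases g) auto
    have "(g * m - 1) div m = g - 1"
      unfolding eq using m by (subst div_mult_self1) simp_all
    then have "fst (xs ! (i - 1)) = g"
      using place_group[OF m nz, of c] ic(2) g by simp
    then show "g \<in> fst ` set xs" using ic(1) nth_mem[of "i - 1" xs] by fastforce
  qed simp
  moreover have "decode m k xs = (Ss, ord)"
  proof -
    have "map (block m xs) [0..<k * m + 1] = Ss"
      using len block by (intro nth_equalityI) (simp_all del: upt_Suc)
    moreover have "orders m xs = ord"
    proof
      fix i show "orders m xs i = ord i"
      proof (cases "i \<in> {1..n}")
        case True
        then show ?thesis using f(2) nth by (simp add: orders_def)
      next
        case False
        then have "ord i = None" using dom by blast
        then show ?thesis using False by (auto simp: orders_def)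
      qed
    qed
    ultimately show ?thesis by (simp add: decode_def)
  qed
  ultimately show ?thesis by (metis imageI)
qed

lemma bij_betw_decode:
  assumes "m \<ge> 1"
  shows "bij_betw (decode m k) (words m n k) (ordered_super_set_partitions m n k)"
proof -
  have "decode m k ` words m n k = ordered_super_set_partitions m n k"
    using decode_in[OF assms] decode_surj[OF assms] by auto
  then show ?thesis using inj_on_decode[OF assms] by (simp add: bij_betw_def)
qed

section \<open>Counting inversions\<close>

text \<open>With \<open>H\<close> the set of groups used so far, the indices beyond
  \<open>g * m - \<rho>\<close> are the last \<open>\<rho>\<close> ones of group \<open>g\<close>
  and all \<open>m\<close> indices of each later group in \<open>H\<close>. For \<open>g = 0\<close>
  the starting index is that of the zero block, and the first part is empty.\<close>

lemma card_positions:
  assumes "m \<ge> 1" "\<rho> < m" "finite H" "g \<le> k" "\<And>h. h \<in> H \<Longrightarrow> h \<le> k"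
    and "g = 0 \<Longrightarrow> \<rho> = 0" "g \<noteq> 0 \<Longrightarrow> g \<in> H"
  shows "card {l. g * m - \<rho> < l \<and> l \<le> k * m \<and> (l - 1) div m + 1 \<in> H} =
    \<rho> + m * card {h \<in> H. g < h}"
proof -
  let ?A = "{g * m - \<rho><..g * m}"
  let ?f = "\<lambda>(h, t). (h - 1) * m + 1 + t"
  let ?B = "?f ` ({h \<in> H. g < h} \<times> {..<m})"
  have gm: "\<rho> \<le> g * m" using assms(2,6) by (cases g) auto
  have B: "l > g * m \<and> (l - 1) div m + 1 \<in> H \<and> l \<le> k * m" if l: "l \<in> ?B" for l
  proof -
    obtain h t where ht: "h \<in> H" "g < h" "t < m" "l = (h - 1) * m + 1 + t" using l by auto
    have "(l - 1) div m = h - 1" using ht by simp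
    then have "(l - 1) div m + 1 \<in> H" using ht by simp
    moreover have "g * m \<le> (h - 1) * m" using ht(2) by (intro mult_le_mono1) simp
    moreover have "h * m \<le> k * m" using assms(5)[OF ht(1)] by (intro mult_le_mono1)
    moreover have "h * m = (h - 1) * m + m" using ht(2) by (cases h) auto
    ultimately show ?thesis using ht(3,4) by linarith
  qed
  have A: "(l - 1) div m + 1 = g" if "l \<in> ?A" for l
  proof -
    have "g \<noteq> 0" using that by (cases g) auto
    then obtain g' where g': "g = Suc g'" by (cases g) auto
    define t where "t = l - 1 - g' * m"
    have "l - 1 = t + g' * m" "t < m" using that assms(2) unfolding g' t_def by auto
    then show ?thesis using g' by simp
  qed
  have "{l. g * m - \<rho> < l \<and> l \<le> k * m \<and> (l - 1) div m + 1 \<in> H} = ?A \<union> ?B"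
  proof (intro equalityI subsetI)
    fix l assume l: "l \<in> {l. g * m - \<rho> < l \<and> l \<le> k * m \<and> (l - 1) div m + 1 \<in> H}"
    show "l \<in> ?A \<union> ?B"
    proof (cases "l \<le> g * m")
      case False
      then have "g \<le> (l - 1) div m" using assms(1) by (simp add: less_eq_div_iff_mult_less_eq)
      moreover have "(l - 1) mod m < m" using assms(1) by simp
      moreover have "l = ?f ((l - 1) div m + 1, (l - 1) mod m)" using False by simp
      ultimately show ?thesis using l by (intro UnI2 image_eqI) auto
    qed (use l in simp)
  next
    fix l assume "l \<in> ?A \<union> ?B"
    then show "l \<in> {l. g * m - \<rho> < l \<and> l \<le> k * m \<and> (l - 1) div m + 1 \<in> H}"
    proof
      assume l: "l \<in> ?A"
      then have "g \<noteq> 0" by (cases g) auto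
      moreover have "l \<le> k * m"
        using l mult_le_mono1[OF assms(4), of m] unfolding greaterThanAtMost_iff by linarith
      ultimately show ?thesis using A[OF l] l assms(7) by simp
    qed (use B in force)
  qed
  moreover have "?A \<inter> ?B = {}" using B by force
  moreover have "inj_on ?f ({h \<in> H. g < h} \<times> {..<m})"
  proof (rule inj_onI, clarsimp)
    fix h h' t t' assume *: "g < h" "g < h'" "t < m" "t' < m"
      "(h - Suc 0) * m + t = (h' - Suc 0) * m + t'"
    have "((h - Suc 0) * m + t) div m = h - Suc 0" using *(3) by simp
    moreover have "((h' - Suc 0) * m + t') div m = h' - Suc 0" using *(4) by simp
    ultimately have "h - Suc 0 = h' - Suc 0" using *(5) by simp
    then show "h = h' \<and> t = t'" using * by simp
  qed
  then have "card ?B = card {h \<in> H. g < h} * m" by (simp add: card_image card_cartesian_product)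
  moreover have "card ?A = \<rho>" using gm by simp
  moreover have "finite ?B" using assms(3) by simp
  ultimately show ?thesis by (simp add: card_Un_disjoint)
qed

text \<open>The order reads \<open>r + 1, ..., m - 1, 0, 1, ..., r\<close>, with color 0 at position
  \<open>m - 1 - r\<close>.\<close>

lemma occurs_after_colored:
  assumes "r < m - 1" "c < m"
  shows "occurs_after (map (\<lambda>d. colored m i (r + 1 + d)) [0..<m]) (colored m i c) (colored m i 0)
    \<longleftrightarrow> c \<in> {1..r}"
proof
  have m: "m \<ge> 1" using assms by simp
  assume "occurs_after (map (\<lambda>d. colored m i (r + 1 + d)) [0..<m]) (colored m i c) (colored m i 0)"
  then obtain a b where ab: "a < b" "b < m" "(r + 1 + a) mod m = 0" "(r + 1 + b) mod m = c"
    using assms(2) by (auto simp: occurs_after_def colored_eq_iff[OF m])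
  have "r + 1 + a = m"
  proof -
    obtain q where q: "r + 1 + a = m * q" using ab(3) by (auto simp: mod_eq_0_iff_dvd)
    \<comment> \<open>Both \<open>r + 1\<close> and \<open>a\<close> are below \<open>m\<close>, so
      their sum can only be the multiple \<open>m\<close> itself.\<close>
    have "m * q < m * 2" using q ab assms by linarith
    then have "q < 2" by simp
    moreover have "q \<noteq> 0" using q by (intro notI) simp
    ultimately have "q = 1" by linarith
    then show ?thesis using q by simp
  qed
  then have "r + 1 + b = m + (b - a)" "b - a < m" using ab by auto
  then have "c = b - a" using ab(4) by simp
  then show "c \<in> {1..r}" using ab \<open>r + 1 + a = m\<close> by auto
next
  have m: "m \<ge> 1" using assms by simp
  assume c: "c \<in> {1..r}"
  let ?L = "map (\<lambda>d. colored m i (r + 1 + d)) [0..<m]"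
  have "?L ! (m - 1 - r) = colored m i 0" "?L ! (m - 1 - r + c) = colored m i c"
    using assms c by (auto simp: colored_eq_iff[OF m])
  then show "occurs_after ?L (colored m i c) (colored m i 0)"
    using c assms unfolding occurs_after_def
    by (intro exI[of _ "m - 1 - r"] exI[of _ "m - 1 - r + c"]) auto
qed

text \<open>Passes from list indices, which start at 0, to bases, which start at 1.\<close>

lemma weight_altdef:
  assumes "length xs = n"
  shows "weight m xs = (\<Sum>i\<in>{1..n}. snd (xs ! (i - 1)) +
    m * card {h \<in> (\<lambda>j. fst (xs ! (j - 1))) ` {1..i}. fst (xs ! (i - 1)) < h})"
proof -
  have "fst ` set (take (Suc i) xs) = (\<lambda>j. fst (xs ! (j - 1))) ` {1..Suc i}" if "i < n" for i
  proof -
    have "set (take (Suc i) xs) = (!) xs ` {..<Suc i}"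
      using that assms nth_image[of "Suc i" xs] by (simp add: lessThan_atLeast0)
    moreover have "{..<Suc i} = (\<lambda>j. j - 1) ` {1..Suc i}"
      by (auto simp: image_iff intro!: bexI[of _ "Suc _"])
    ultimately show ?thesis by (simp add: image_image)
  qed
  then show ?thesis
    unfolding weight_def assms
    by (intro sum.reindex_bij_witness[of _ "\<lambda>i. i - 1" Suc]) auto
qed

text \<open>A base with a letter in a group has a color in each block of it, so all blocks of the
  group share the least base, namely the first one that uses the group.\<close>

lemma minb_block_le_iff:
  assumes m: "m \<ge> 1" and xs: "xs \<in> words m n k" and l: "l \<in> {1..k * m}" and i: "i \<in> {1..n}"
  shows "minb m (block m xs l) \<le> i \<longleftrightarrow>
    (l - 1) div m + 1 \<in> (\<lambda>j. fst (xs ! (j - 1))) ` {1..i}"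
proof -
  let ?Q = "\<lambda>j. j \<in> {1..n} \<and> fst (xs ! (j - 1)) = (l - 1) div m + 1"
  have len: "length xs = n" using xs by (simp add: words_def)
  have Q: "(\<exists>c<m. colored m j c \<in> block m xs l) \<longleftrightarrow> ?Q j" for j
  proof
    assume "\<exists>c<m. colored m j c \<in> block m xs l"
    then obtain c where c: "j \<in> {1..n}" "place m (xs ! (j - 1)) c = l"
      using colored_in_block[OF m] len by auto
    then have "place m (xs ! (j - 1)) c \<noteq> 0" using l by simp
    then have "fst (xs ! (j - 1)) \<noteq> 0" unfolding place_eq_0_iff .
    then show "?Q j" using place_group[OF m, of "xs ! (j - 1)" c] c by simp
  next
    assume j: "?Q j"
    then have "\<exists>c<m. place m (xs ! (j - 1)) c = l"
      using l by (intro ex_place[OF words_nth[OF xs]]) auto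
    then show "\<exists>c<m. colored m j c \<in> block m xs l"
      using j len by (simp add: colored_in_block[OF m])
  qed
  have "l - 1 < k * m" using l by auto
  then have "(l - 1) div m + 1 \<in> {1..k}" by (simp add: less_mult_imp_div_less Suc_le_eq)
  then have "\<exists>j. ?Q j" using words_used[OF xs] by blast
  \<comment> \<open>\<open>LEAST\<close> is meaningful because words use every group.\<close>
  then have least: "?Q (LEAST j. ?Q j)" by (rule LeastI_ex)
  have "minb m (block m xs l) = (LEAST j. ?Q j)"
    using l by (simp add: minb_def zero_vec_in_block Q)
  moreover have "(LEAST j. ?Q j) \<le> i \<longleftrightarrow> (\<exists>j\<le>i. ?Q j)"
    using least Least_le[of ?Q] by (meson le_trans)
  moreover have "(\<exists>j\<le>i. ?Q j) \<longleftrightarrow> (l - 1) div m + 1 \<in> (\<lambda>j. fst (xs ! (j - 1))) ` {1..i}"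
  proof -
    have "{1..i} = {j \<in> {1..n}. j \<le> i}" using i by auto
    then show ?thesis unfolding image_iff Bex_def by (metis (no_types, lifting) mem_Collect_eq)
  qed
  ultimately show ?thesis by simp
qed

text \<open>Summing over bases \<open>i\<close>: the block inversions are the indices beyond the
  block of color 0 whose group is used by a base at most \<open>i\<close>, counted by
  \<open>card_positions\<close>. Order inversions supply the summand \<open>r\<close> for bases in
  the zero block.\<close>

lemma inv_count_decode:
  assumes m: "m \<ge> 1" and xs: "xs \<in> words m n k"
  shows "inv_count m (decode m k xs) = weight m xs"
proof -
  let ?Ss = "map (block m xs) [0..<k * m + 1]"
  define g where "g i = fst (xs ! (i - 1))" for i
  define r where "r i = snd (xs ! (i - 1))" for i
  \<comment> \<open>The share of \<open>r\<close> coming from block inversions; in the zero block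
    \<open>r\<close> counts order inversions instead.\<close>
  define R where "R i = (if g i = 0 then 0 else r i)" for i
  have len: "length xs = n" using xs by (simp add: words_def)
  have nth: "?Ss ! l = block m xs l" if "l \<le> k * m" for l
    using that nth_map_upt[of l "k * m + 1" 0] by simp
  have letter: "g i \<le> k" "g i = 0 \<Longrightarrow> r i < m - 1" "r i < m" if "i \<in> {1..n}" for i
    using words_nth[OF xs that] by (auto simp: letters_def g_def r_def)
  have place_eq: "place m (xs ! (i - 1)) 0 = g i * m - R i" if "i \<in> {1..n}" for i
    using place_0[OF words_nth[OF xs that]] by (simp add: g_def r_def R_def)
  define L where "L i = {l. g i * m - R i < l \<and> l \<le> k * m \<and> (l - 1) div m + 1 \<in> g ` {1..i}}" for i
  have "block_inversions m ?Ss = (\<lambda>(i, l). (colored m i 0, block m xs l)) ` (SIGMA i:{1..n}. L i)"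
  proof (intro equalityI subsetI)
    fix p assume "p \<in> block_inversions m ?Ss"
    then obtain i j l where p: "p = (colored m i 0, ?Ss ! l)" "j < l" "l \<le> k * m"
      "colored m i 0 \<in> ?Ss ! j" "minb m (?Ss ! l) \<le> i"
      by (auto simp: block_inversions_def simp del: upt_Suc)
    then have i: "i \<in> {1..n}" "j = g i * m - R i"
      using nth[of j] place_eq len colored_in_block[OF m, of i 0 xs j] by auto
    then have "l \<in> L i"
      using p nth[of l] minb_block_le_iff[OF m xs _ i(1), of l]
      by (simp add: L_def g_def[abs_def])
    then show "p \<in> (\<lambda>(i, l). (colored m i 0, block m xs l)) ` (SIGMA i:{1..n}. L i)"
      using i p nth[of l] by (intro image_eqI[of _ _ "(i, l)"]) auto
  next
    fix p assume "p \<in> (\<lambda>(i, l). (colored m i 0, block m xs l)) ` (SIGMA i:{1..n}. L i)"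
    then obtain i l where p: "p = (colored m i 0, block m xs l)" "i \<in> {1..n}" "l \<in> L i" by auto
    define j where "j = g i * m - R i"
    have jl: "j < l" "l \<le> k * m" using p(3) by (simp_all add: L_def j_def)
    have "colored m i 0 \<in> ?Ss ! j"
      using nth[of j] jl p(2) len place_eq[OF p(2)] by (simp add: colored_in_block[OF m] j_def)
    moreover have "minb m (?Ss ! l) \<le> i"
      using nth[OF jl(2)] minb_block_le_iff[OF m xs _ p(2), of l] p(3) jl
      by (simp add: L_def g_def[abs_def])
    moreover have "p = (colored m i 0, ?Ss ! l)" "l < length ?Ss" using p(1) nth[OF jl(2)] jl by simp_all
    ultimately show "p \<in> block_inversions m ?Ss"
      unfolding block_inversions_def using jl(1) by blast
  qed
  \<comment> \<open>Inversions are pairs of a vector and a block. The blocks are nonempty and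
    disjoint, so different indices give different pairs.\<close>
  moreover have "inj_on (\<lambda>(i, l). (colored m i 0, block m xs l)) (SIGMA i:{1..n}. L i)"
  proof (rule inj_onI, clarsimp)
    fix i l i' l' assume *: "l \<in> L i" "block m xs l = block m xs l'"
      "colored m i 0 = colored m i' 0"
    then have "l \<le> k * m" by (simp add: L_def)
    then have "block m xs l \<noteq> {}" by (rule block_nonempty[OF m xs])
    then show "i = i' \<and> l = l'"
      using * block_disjoint[OF m] colored_eq_iff[OF m] by blast
  qed
  moreover have "finite (L i)" for i
    by (rule finite_subset[of _ "{..k * m}"]) (auto simp: L_def)
  ultimately have blocks: "card (block_inversions m ?Ss) = (\<Sum>i\<in>{1..n}. card (L i))"
    by (simp add: card_image)
  have card_L: "card (L i) = R i + m * card {h \<in> g ` {1..i}. g i < h}" if i: "i \<in> {1..n}" for i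
    unfolding L_def
  proof (rule card_positions[OF m])
    show "h \<le> k" if "h \<in> g ` {1..i}" for h using that letter(1) i by auto
  qed (use i letter[OF i] m in \<open>auto simp: R_def\<close>)
  have "order_inversions m (?Ss ! 0) (orders m xs) =
    (\<lambda>(i, c). (colored m i 0, colored m i c)) ` (SIGMA i:{i \<in> {1..n}. g i = 0}. {1..r i})"
  proof (intro equalityI subsetI)
    fix p assume "p \<in> order_inversions m (?Ss ! 0) (orders m xs)"
    then obtain i c K where p: "p = (colored m i 0, colored m i c)" "c < m"
      "orders m xs i = Some K" "occurs_after K (colored m i c) (colored m i 0)"
      unfolding order_inversions_def by blast
    then have i: "i \<in> {1..n}" "g i = 0" "K = map (\<lambda>d. colored m i (r i + 1 + d)) [0..<m]"
      using len by (auto simp: orders_def letter_order_def g_def r_def split: if_splits)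
    then have "c \<in> {1..r i}" using p occurs_after_colored[OF letter(2)[OF i(1,2)] p(2)] by simp
    then show "p \<in> (\<lambda>(i, c). (colored m i 0, colored m i c)) `
        (SIGMA i:{i \<in> {1..n}. g i = 0}. {1..r i})"
      using i p(1) by (intro image_eqI[of _ _ "(i, c)"]) auto
  next
    fix p assume "p \<in> (\<lambda>(i, c). (colored m i 0, colored m i c)) `
        (SIGMA i:{i \<in> {1..n}. g i = 0}. {1..r i})"
    then obtain i c where p: "p = (colored m i 0, colored m i c)" "i \<in> {1..n}" "g i = 0"
      "c \<in> {1..r i}" by auto
    then have c: "c < m" using letter(3)[of i] by simp
    have "colored m i d \<in> ?Ss ! 0" for d
      using nth[of 0] p len by (simp add: colored_in_block[OF m] place_eq_0_iff g_def)
    moreover have "orders m xs i = Some (map (\<lambda>d. colored m i (r i + 1 + d)) [0..<m])"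
      using p len by (simp add: orders_def letter_order_def g_def r_def)
    moreover have "occurs_after (map (\<lambda>d. colored m i (r i + 1 + d)) [0..<m])
        (colored m i c) (colored m i 0)"
      using p(4) occurs_after_colored[OF letter(2)[OF p(2,3)] c] by blast
    ultimately show "p \<in> order_inversions m (?Ss ! 0) (orders m xs)"
      unfolding order_inversions_def using p(1) c by blast
  qed
  moreover have "inj_on (\<lambda>(i, c). (colored m i 0, colored m i c))
      (SIGMA i:{i \<in> {1..n}. g i = 0}. {1..r i})"
  proof (rule inj_onI)
    fix p p' assume "p \<in> (SIGMA i:{i \<in> {1..n}. g i = 0}. {1..r i})"
      "p' \<in> (SIGMA i:{i \<in> {1..n}. g i = 0}. {1..r i})"
      and eq: "(\<lambda>(i, c). (colored m i 0, colored m i c)) p =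
        (\<lambda>(i, c). (colored m i 0, colored m i c)) p'"
    then obtain i c i' c' where p: "p = (i, c)" "p' = (i', c')" "i \<in> {1..n}" "i' \<in> {1..n}"
      "c \<le> r i" "c' \<le> r i'" by auto
    then have "c < m" "c' < m" using letter(3)[of i] letter(3)[of i'] by simp_all
    then show "p = p'" using p eq colored_eq_iff[OF m] by simp
  qed
  ultimately have "card (order_inversions m (?Ss ! 0) (orders m xs)) =
    (\<Sum>i\<in>{i \<in> {1..n}. g i = 0}. r i)"
    by (simp add: card_image)
  also have "\<dots> = (\<Sum>i\<in>{1..n}. if g i = 0 then r i else 0)"
    by (rule sum.inter_filter) simp
  finally have orders: "card (order_inversions m (?Ss ! 0) (orders m xs)) =
    (\<Sum>i\<in>{1..n}. if g i = 0 then r i else 0)" .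
  have "inv_count m (decode m k xs) =
    (\<Sum>i\<in>{1..n}. card (L i) + (if g i = 0 then r i else 0))"
    unfolding decode_def inv_count_def prod.case blocks orders sum.distrib ..
  also have "\<dots> = (\<Sum>i\<in>{1..n}. r i + m * card {h \<in> g ` {1..i}. g i < h})"
    by (rule sum.cong[OF refl]) (simp add: card_L R_def)
  also have "\<dots> = weight m xs"
    unfolding weight_altdef[OF len] g_def[abs_def] r_def ..
  finally show ?thesis .
qed

theorem theorem4p4:
  fixes m n k :: nat
  assumes "m \<ge> 1"
  shows "super_ordered_stirling m n k =
    (\<Sum>\<omega>\<in>ordered_super_set_partitions m n k. monom 1 (inv_count m \<omega>))"
proof -
  have "(\<Sum>\<omega>\<in>ordered_super_set_partitions m n k. monom 1 (inv_count m \<omega>)) =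
    (\<Sum>xs\<in>words m n k. monom (1::int) (inv_count m (decode m k xs)))"
    by (rule sum.reindex_bij_betw[OF bij_betw_decode[OF assms], symmetric])
  also have "\<dots> = super_ordered_stirling m n k"
    using words_sum[OF assms] by (simp add: inv_count_decode[OF assms])
  finally show ?thesis ..
qed

end
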